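(* Let $G=(V,D,B)$ be a mixed graph on $n$ vertices, $V=[n]$. Let $\Lambda\in\mathbb{R}^D_{\mathrm{reg}}$ and $\Omega=[\omega_{ij}]\in PD(B)$, and let $\Sigma=[\sigma_{ij}]=(I-\Lambda)^{-T}\,\Omega\,(I-\Lambda)^{-1}$. Then for all $i,j\in[n]$, $$\sigma_{ij}=\frac{\displaystyle\sum_{k,l=1}^n\Big[\sum_{C\in\mathcal{C}_{l\to i}}(-1)^{c(C)+1}w(C)\Big]\,\omega_{lk}\,\Big[\sum_{C'\in\mathcal{C}_{k\to j}}(-1)^{c(C')+1}w(C')\Big]}{\displaystyle\Big[\sum_{L\in\mathcal{L}}(-1)^{c(L)}w(L)\Big]^2},$$ where $\mathcal{L}$ is the set of linear subgraphs of the weighted directed graph $\widetilde{D}$, and $\mathcal{C}_{a\to b}$ is the set of 1-connections of $\widetilde{D}$ from $a$ to $b$.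
   Context: A mixed graph $G=(V,D,B)$ has vertex set $V=[n]=\{1,\dots,n\}$, a set $D$ of directed edges $(i,j)$ with $i\ne j$ (directed cycles are allowed), and a set $B$ of bidirected edges $i\leftrightarrow j$ with $i\neq j$. $\mathbb{R}^D$ is the set of matrices $\Lambda=(\lambda_{ij})\in\mathbb{R}^{n\times n}$ with $\lambda_{ij}\neq 0$ if and only if $(i,j)\in D$; $\mathbb{R}^D_{\mathrm{reg}}$ is the set of $\Lambda\in\mathbb{R}^D$ such that $I-\Lambda$ is invertible. $PD(B)$ is the set of symmetric positive definite real $n\times n$ matrices $\Omega=(\omega_{ij})$ with $\omega_{ij}=0$ whenever $i\ne j$ and $i\leftrightarrow j\notin B$. $A^{-T}$ denotes $(A^{-1})^T$. $\widetilde{D}$ is the weighted directed graph on $V$ with edge set $D\cup\{(i,i): i\in V\}$, in which each self-loop $(i,i)$ has weight $1$ and each edge $(i,j)\in D$ has weight $-\lambda_{ij}$ (so the weight matrix is $I-\Lambda$). A spanning subgraph of a directed graph is a subgraph with the same vertex set. A self-loop contributes one to both the indegree and the outdegree of its vertex. A linear subgraph is a spanning subgraph in which every vertex has indegree 1 and outdegree 1. A 1-connection from $i$ to $j$ is a spanning subgraph such that: if $i\neq j$, then $i$ has indegree 0 and outdegree 1, $j$ has indegree 1 and outdegree 0, and every other vertex has indegree 1 and outdegree 1; if $i=j$, then $i$ has indegree 0 and outdegree 0, and every other vertex has indegree 1 and outdegree 1. For a subgraph $H$ of $\widetilde{D}$, $w(H)$ is the product of the weights of all edges of $H$ (with $w(H)=1$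 if $H$ has no edges), and $c(H)$ is the number of directed cycles (including self-loops) contained in $H$. *)

theory Defs
  imports "HOL-Analysis.Analysis" "Graph_Theory.Digraph_Component"
begin

text \<open>The vertex set \<open>[n]\<close> is the universe of an arbitrary finite type \<open>'n\<close> (so
  \<open>n = CARD('n)\<close>), which also indexes the rows and columns of all matrices.  A bidirected
  edge between \<open>i\<close> and \<open>j\<close> is the unordered pair \<open>{i, j}\<close>.\<close>

definition mixed_graph :: "('n::finite \<times> 'n) set \<Rightarrow> 'n set set \<Rightarrow> bool" where
  "mixed_graph D B \<longleftrightarrow>
     (\<forall>(i, j) \<in> D. i \<noteq> j) \<and> (\<forall>e \<in> B. \<exists>i j. i \<noteq> j \<and> e = {i, j})"

definition R_D :: "('n::finite \<times> 'n) set \<Rightarrow> (real^'n^'n) set" where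
  "R_D D = {\<Lambda>. \<forall>i j. \<Lambda> $ i $ j \<noteq> 0 \<longleftrightarrow> (i, j) \<in> D}"

definition R_D_reg :: "('n::finite \<times> 'n) set \<Rightarrow> (real^'n^'n) set" where
  "R_D_reg D = {\<Lambda> \<in> R_D D. invertible (mat 1 - \<Lambda>)}"

definition pos_def :: "real^'n^'n \<Rightarrow> bool" where
  "pos_def A \<longleftrightarrow> transpose A = A \<and> (\<forall>x. x \<noteq> 0 \<longrightarrow> x \<bullet> (A *v x) > 0)"

definition PD :: "'n::finite set set \<Rightarrow> (real^'n^'n) set" where
  "PD B = {\<Omega>. pos_def \<Omega> \<and> (\<forall>i j. i \<noteq> j \<and> {i, j} \<notin> B \<longrightarrow> \<Omega> $ i $ j = 0)}"

definition D_tilde :: "('n::finite \<times> 'n) set \<Rightarrow> 'n pair_pre_digraph" where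
  "D_tilde D = \<lparr> pverts = UNIV, parcs = D \<union> {(i, i) | i. True} \<rparr>"

definition edge_weight :: "real^'n^'n \<Rightarrow> 'n \<times> 'n \<Rightarrow> real" where
  "edge_weight \<Lambda> = (\<lambda>(i, j). if i = j then 1 else - \<Lambda> $ i $ j)"

definition weight :: "real^'n^'n \<Rightarrow> 'n pair_pre_digraph \<Rightarrow> real" where
  "weight \<Lambda> H = (\<Prod>e \<in> parcs H. edge_weight \<Lambda> e)"

text \<open>A directed cycle is counted through its arc set, so that the closed arc walks
  that differ only in their starting point are counted once.  The library's
  \<^const>\<open>pre_digraph.cycle\<close> admits loops.\<close>

definition num_cycles :: "'n pair_pre_digraph \<Rightarrow> nat" where
  "num_cycles H = card {set p | p. pre_digraph.cycle (with_proj H) p}"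

definition linear_subgraphs :: "'n pair_pre_digraph \<Rightarrow> 'n pair_pre_digraph set" where
  "linear_subgraphs G = {H. spanning (with_proj H) (with_proj G) \<and>
     (\<forall>v \<in> pverts H. in_degree (with_proj H) v = 1 \<and> out_degree (with_proj H) v = 1)}"

definition one_connections ::
  "'n pair_pre_digraph \<Rightarrow> 'n \<Rightarrow> 'n \<Rightarrow> 'n pair_pre_digraph set" where
  "one_connections G i j = {H. spanning (with_proj H) (with_proj G) \<and>
     (if i \<noteq> j then
        in_degree (with_proj H) i = 0 \<and> out_degree (with_proj H) i = 1 \<and>
        in_degree (with_proj H) j = 1 \<and> out_degree (with_proj H) j = 0
      else
        in_degree (with_proj H) i = 0 \<and> out_degree (with_proj H) i = 0) \<and>
     (\<forall>v \<in> pverts H - {i, j}.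
        in_degree (with_proj H) v = 1 \<and> out_degree (with_proj H) v = 1)}"

lemma finite_spanning_pair:
  fixes G :: "'n::finite pair_pre_digraph"
  shows "finite {H :: 'n pair_pre_digraph. spanning (with_proj H) (with_proj G)}"
proof (rule finite_subset)
  show "{H :: 'n pair_pre_digraph. spanning (with_proj H) (with_proj G)}
    \<subseteq> (\<lambda>(V, E). \<lparr> pverts = V, parcs = E \<rparr>) ` UNIV"
  proof
    fix H :: "'n pair_pre_digraph"
    show "H \<in> (\<lambda>(V, E). \<lparr> pverts = V, parcs = E \<rparr>) ` UNIV"
      by (rule image_eqI[of _ _ "(pverts H, parcs H)"]) simp_all
  qed
qed simp

lemma finite_linear_subgraphs:
  "finite (linear_subgraphs (G :: 'n::finite pair_pre_digraph))"
  unfolding linear_subgraphs_def by (rule finite_subset[OF _ finite_spanning_pair[of G]]) blast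

lemma finite_one_connections:
  "finite (one_connections (G :: 'n::finite pair_pre_digraph) i j)"
  unfolding one_connections_def by (rule finite_subset[OF _ finite_spanning_pair[of G]]) blast

lemma edge_weight_eq:
  assumes "mixed_graph D B" and "\<Lambda> \<in> R_D D"
  shows "edge_weight \<Lambda> (i, j) = (mat 1 - \<Lambda>) $ i $ j"
proof -
  have "(i, j) \<notin> D" if "i = j" using assms(1) that by (auto simp: mixed_graph_def)
  then show ?thesis using assms(2) by (auto simp: R_D_def edge_weight_def mat_def)
qed

end

theory Submission
  imports Defs "HOL-Combinatorics.Orbits"
begin

text \<open>Linear subgraphs are the graphs of the permutations all of whose arcs exist, and their
  cycles are the orbits.  A permutation with \<open>c\<close> orbits has sign \<open>(-1)\<^sup>n\<^sup>+\<^sup>c\<close>, so the Leibniz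
  formula identifies the signed sum over linear subgraphs with \<open>(-1)\<^sup>n det (I - \<Lambda>)\<close>.  Closing up a
  1-connection from \<open>l\<close> to \<open>i\<close> by the arc \<open>(i, l)\<close> gives a permutation mapping \<open>i\<close> to \<open>l\<close> with
  exactly one more cycle, so by Cramer's rule these sums are the entries of \<open>(I - \<Lambda>)\<^sup>-\<^sup>1\<close>
  times the same factor, which cancels in the quotient.\<close>

section \<open>The sign of a permutation in terms of its orbits\<close>

text \<open>Composing with the transposition makes \<open>a\<close> a fixed point and sends the
  predecessor of \<open>a\<close> straight to \<open>p a\<close>, so every other orbit walk merely
  skips \<open>a\<close>.\<close>

lemma orbit_bypass_fixed_point:
  assumes p: "inj p" and x: "x \<noteq> a" and ne: "p a \<noteq> a"
  shows "orbit (Transposition.transpose a (p a) \<circ> p) x = orbit p x - {a}"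
proof -
  define q where "q = Transposition.transpose a (p a) \<circ> p"
  have q: "q y = (if p y = a then p a else p y)" if "y \<noteq> a" for y
    using that p by (auto simp: q_def Transposition.transpose_def dest: injD)
  have 1: "y \<in> orbit p x \<and> y \<noteq> a" if "y \<in> orbit q x" for y
    using that
  proof induction
    case base
    have "p x \<in> orbit p x" by (rule orbit.base)
    then show ?case using q[OF x] ne by (auto intro: orbit.step)
  next
    case (step y)
    then have "p y \<in> orbit p x" by (auto intro: orbit.step)
    then show ?case using q[of y] ne step by (auto intro: orbit.step)
  qed
  \<comment> \<open>When the walk along \<open>p\<close> reaches \<open>a\<close>, the invariant
    records the next point \<open>p a\<close> instead, since that is where the bypass lands.\<close>
  have 2: "(if y = a then p a else y) \<in> orbit q x" if "y \<in> orbit p x" for y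
    using that
  proof induction
    case base
    show ?case using q[OF x] orbit.base[of q x] by auto
  next
    case (step y)
    show ?case
    proof (cases "y = a")
      case True
      then show ?thesis using step ne by auto
    next
      case False
      then have "q y \<in> orbit q x" using step by (auto intro: orbit.step)
      then show ?thesis using q[OF False] by auto
    qed
  qed
  have "y \<in> orbit q x" if "y \<in> orbit p x" "y \<noteq> a" for y
    using 2[OF that(1)] that(2) by simp
  with 1 show ?thesis unfolding q_def[symmetric] by blast
qed

lemma orbit_eq_if_mem:
  assumes "permutation p" "y \<in> orbit p x"
  shows "orbit p y = orbit p x"
  using orbit_cyclic_eq3[OF cyclic_on_orbit'[OF assms(1)] assms(2)] .

text \<open>Induction by bypassing \<open>a\<close>. If \<open>a\<close> is fixed, one point and one
  orbit disappear and the sign stays; otherwise the sign flips, one point disappears and the number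
  of orbits stays. The sum in the exponent has the parity of the usual difference and avoids
  subtraction of naturals.\<close>

lemma sign_eq_orbits:
  assumes "finite S" "p permutes S"
  shows "sign p = (-1) ^ (card S + card (orbit p ` S))"
  using assms
proof (induction S arbitrary: p rule: finite_induct)
  case empty
  then show ?case by (simp add: sign_id)
next
  case (insert a S)
  define q where "q = Transposition.transpose a (p a) \<circ> p"
  have q: "q permutes S" unfolding q_def using insert.prems by (rule permutes_insert_lemma)
  have perm: "permutation p" using insert.prems insert.hyps(1) permutation_permutes by blast
  have permq: "permutation q" using q insert.hyps(1) permutation_permutes by blast
  have injp: "inj p" using insert.prems permutes_inj by blast
  have IH: "sign q = (-1) ^ (card S + card (orbit q ` S))" using insert.IH[OF q] .
  show ?case
  proof (cases "p a = a")
    case True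
    then have "q = p" by (simp add: q_def)
    have oa: "orbit p a = {a}" using True orbit_eq_singleton_iff by metis
    have "{a} \<notin> orbit p ` S"
    proof
      assume "{a} \<in> orbit p ` S"
      then obtain x where "x \<in> S" "orbit p x = {a}" by auto
      then show False using permutation_self_in_orbit[OF perm, of x] insert.hyps(2) by auto
    qed
    then show ?thesis using IH \<open>q = p\<close> oa insert.hyps by simp
  next
    case False
    have "p = Transposition.transpose a (p a) \<circ> q" by (simp add: q_def fun_eq_iff)
    then have "sign p = sign (Transposition.transpose a (p a)) * sign q"
      by (metis permq permutation_swap_id sign_compose)
    then have s: "sign p = - sign q" using False by (simp add: sign_swap_id)
    \<comment> \<open>The point \<open>p a\<close> represents the orbit of \<open>a\<close>, so
      discarding \<open>a\<close> as a starting point loses no orbit.\<close>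
    have pa: "p a \<in> S" using False insert.prems permutes_in_image[of p "insert a S" a] by auto
    have oa: "orbit p a = orbit p (p a)"
      by (rule orbit_eq_if_mem[OF perm, symmetric]) (rule orbit.base)
    then have im: "orbit p ` insert a S = orbit p ` S" using pa by auto
    have "orbit q ` S = (\<lambda>O'. O' - {a}) ` orbit p ` S"
      unfolding image_image q_def
      by (rule image_cong[OF refl], rule orbit_bypass_fixed_point[OF injp _ False])
        (use insert.hyps in auto)
    \<comment> \<open>Each orbit keeps its starting point, which differs from \<open>a\<close>, and
      orbits with a common point coincide.\<close>
    moreover have "inj_on (\<lambda>O'. O' - {a}) (orbit p ` S)"
    proof (rule inj_onI, clarify)
      fix x y assume xy: "x \<in> S" "y \<in> S" "orbit p x - {a} = orbit p y - {a}"
      have "x \<noteq> a" using xy insert.hyps by auto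
      then have "x \<in> orbit p y" using xy permutation_self_in_orbit[OF perm, of x] by auto
      then show "orbit p x = orbit p y" using orbit_eq_if_mem[OF perm] by blast
    qed
    ultimately have "card (orbit q ` S) = card (orbit p ` insert a S)"
      by (simp only: card_image im)
    then show ?thesis using s IH insert.hyps by simp
  qed
qed

section \<open>Subgraphs given by permutations\<close>

text \<open>The set \<open>S\<close> holds the tails of the retained arcs: \<open>UNIV\<close>
  serves for linear subgraphs, \<open>- {i}\<close> for 1-connections ending at
  \<open>i\<close>.\<close>

definition perm_graph :: "('n \<Rightarrow> 'n) \<Rightarrow> 'n set \<Rightarrow> 'n pair_pre_digraph" where
  "perm_graph p S = \<lparr> pverts = UNIV, parcs = (\<lambda>v. (v, p v)) ` S \<rparr>"

lemma perm_graph_simps [simp]: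
  "pverts (perm_graph p S) = UNIV"
  "parcs (perm_graph p S) = (\<lambda>v. (v, p v)) ` S"
  by (simp_all add: perm_graph_def)

section \<open>Closed walks and orbits\<close>

definition iterate_walk :: "('n \<Rightarrow> 'n) \<Rightarrow> 'n \<Rightarrow> nat \<Rightarrow> ('n \<times> 'n) list" where
  "iterate_walk p u n = map (\<lambda>k. ((p ^^ k) u, p ((p ^^ k) u))) [0..<n]"

lemma iterate_walk_Suc: "iterate_walk p u (Suc n) = (u, p u) # iterate_walk p (p u) n"
  unfolding iterate_walk_def
  by (simp add: upt_conv_Cons map_Suc_upt[symmetric] funpow_swap1 del: upt_Suc)

lemma length_iterate_walk [simp]: "length (iterate_walk p u n) = n"
  by (simp add: iterate_walk_def)

lemma set_iterate_walk: "set (iterate_walk p u n) = (\<lambda>v. (v, p v)) ` {(p ^^ k) u | k. k < n}"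
  by (simp add: iterate_walk_def atLeast0LessThan lessThan_def setcompr_eq_image image_image)

lemma pcas_iterate_walk: "pcas u (iterate_walk p u n) ((p ^^ n) u)"
proof (induction n arbitrary: u)
  case (Suc n)
  show ?case using Suc[of "p u"] by (simp add: iterate_walk_Suc funpow_swap1)
qed (simp add: iterate_walk_def)

text \<open>Each vertex has at most one outgoing arc, so a walk is determined by its start and its
  length.\<close>

lemma pcas_imp_iterate_walk:
  assumes "set es \<subseteq> range (\<lambda>v. (v, p v))" "pcas u es w"
  shows "es = iterate_walk p u (length es)" "w = (p ^^ length es) u"
  using assms
proof (induction es arbitrary: u)
  case Nil
  { case 1 then show ?case by (simp add: iterate_walk_def) }
  { case 2 then show ?case by simp }
next
  case (Cons e es)
  { case 1 then show ?case using Cons(1)[of "p u"] by (auto simp: iterate_walk_Suc) }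
  { case 2 then show ?case using Cons(2)[of "p u"] by (auto simp: funpow_swap1) }
qed

text \<open>Distinctness in the definition of a cycle concerns the vertex list without its first
  entry; along a walk this is the list of arc heads.\<close>

lemma tl_pawalk_verts: "pcas u es w \<Longrightarrow> tl (pawalk_verts u es) = map snd es"
proof -
  have "pawalk_verts u es = u # map snd es" if "pcas u es w" for u
    using that by (induction es arbitrary: u) auto
  then show "pcas u es w \<Longrightarrow> tl (pawalk_verts u es) = map snd es" by simp
qed

text \<open>A closed walk runs through a whole orbit, and an orbit inside \<open>S\<close> is
  traversed once by a cycle. An orbit not inside \<open>S\<close> is broken at a missing
  arc.\<close>

lemma cycle_arcs_perm_graph:
  fixes p :: "'n::finite \<Rightarrow> 'n"
  assumes p: "p permutes UNIV"
  shows "{set es | es. pre_digraph.cycle (with_proj (perm_graph p S)) es} =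
    image (\<lambda>v. (v, p v)) ` {O' \<in> range (orbit p). O' \<subseteq> S}"
proof -
  have perm: "permutation p" unfolding permutation_permutes using p finite by blast
  have cyc: "pre_digraph.cycle (with_proj (perm_graph p S)) es \<longleftrightarrow>
      (\<exists>u. set es \<subseteq> (\<lambda>v. (v, p v)) ` S \<and> pcas u es u \<and> distinct (map snd es) \<and> es \<noteq> [])" for es
    unfolding pre_digraph.cycle_def pre_digraph.awalk_def
    by (auto simp: cas_with_proj_eq awalk_verts_with_proj_eq tl_pawalk_verts)
  show ?thesis
  proof (intro equalityI subsetI)
    fix X assume "X \<in> {set es | es. pre_digraph.cycle (with_proj (perm_graph p S)) es}"
    then obtain es u where X: "X = set es" and es: "set es \<subseteq> (\<lambda>v. (v, p v)) ` S"
      and u: "pcas u es u" "es \<noteq> []" unfolding cyc by auto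
    have "set es \<subseteq> range (\<lambda>v. (v, p v))" using es by auto
    from pcas_imp_iterate_walk[OF this u(1)]
    have walk: "es = iterate_walk p u (length es)" and close: "u = (p ^^ length es) u" .
    \<comment> \<open>Any positive \<open>n\<close> with \<open>(p ^^ n) u = u\<close> enumerates
      the whole orbit; the length of the closed walk is such an \<open>n\<close>.\<close>
    have orb: "orbit p u = {(p ^^ k) u | k. k < length es}"
      using orbit_altdef_bounded[where f = p and n = "length es" and s = u] close u(2) by simp
    have X': "X = (\<lambda>v. (v, p v)) ` orbit p u"
      unfolding X orb set_iterate_walk[symmetric] by (rule arg_cong[OF walk])
    have "orbit p u \<subseteq> S" using es X X' by auto
    with X' show "X \<in> image (\<lambda>v. (v, p v)) ` {O' \<in> range (orbit p). O' \<subseteq> S}" by blast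
  next
    fix X assume "X \<in> image (\<lambda>v. (v, p v)) ` {O' \<in> range (orbit p). O' \<subseteq> S}"
    then obtain u where X: "X = (\<lambda>v. (v, p v)) ` orbit p u" and S: "orbit p u \<subseteq> S" by auto
    have self: "u \<in> orbit p u" using permutation_self_in_orbit[OF perm] .
    \<comment> \<open>This is the least positive period of \<open>u\<close>: the iterates before the
      first return are distinct, as a cycle demands.\<close>
    define N where "N = funpow_dist1 p u u"
    have N: "(p ^^ N) u = u" "0 < N"
      unfolding N_def using funpow_dist1_prop[OF self] by auto
    have orb: "orbit p u = {(p ^^ k) u | k. k < N}"
      using orbit_altdef_bounded[OF N] .
    define es where "es = iterate_walk p u N"
    have set_es: "set es = X" unfolding es_def X orb by (rule set_iterate_walk)
    have "inj_on (\<lambda>k. (p ^^ k) u) {0..<N}"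
      unfolding N_def by (rule inj_on_funpow_dist1[OF self])
    then have "inj_on (\<lambda>k. p ((p ^^ k) u)) {0..<N}"
      using permutes_inj[OF p] by (auto simp: inj_on_def)
    then have "distinct (map snd es)"
      by (simp add: es_def iterate_walk_def distinct_map comp_def)
    moreover have "pcas u es u" using pcas_iterate_walk[of u p N] N by (simp add: es_def)
    moreover have "es \<noteq> []" using N(2) by (metis es_def length_iterate_walk less_numeral_extra(3) list.size(3))
    moreover have "set es \<subseteq> (\<lambda>v. (v, p v)) ` S" unfolding set_es X using S by auto
    ultimately show "X \<in> {set es | es. pre_digraph.cycle (with_proj (perm_graph p S)) es}"
      unfolding cyc using set_es by blast
  qed
qed

section \<open>Cycle counts and signs\<close>

lemma num_cycles_perm_graph:
  fixes p :: "'n::finite \<Rightarrow> 'n"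
  assumes "p permutes UNIV"
  shows "num_cycles (perm_graph p S) = card {O' \<in> range (orbit p). O' \<subseteq> S}"
proof -
  have "inj (\<lambda>v. (v, p v))" by (auto intro: injI)
  then show ?thesis
    unfolding num_cycles_def cycle_arcs_perm_graph[OF assms]
    by (intro card_image) (auto intro: inj_on_subset inj_on_image)
qed

lemma sign_perm_graph_UNIV:
  fixes p :: "'n::finite \<Rightarrow> 'n"
  assumes "p permutes UNIV"
  shows "(-1) ^ num_cycles (perm_graph p UNIV) = (-1) ^ CARD('n) * sign p"
proof -
  have "sign p = (-1) ^ CARD('n) * (-1) ^ num_cycles (perm_graph p UNIV)"
    using sign_eq_orbits[OF finite assms] by (simp add: num_cycles_perm_graph[OF assms] power_add)
  then show ?thesis by simp
qed

text \<open>Deleting the arc out of \<open>i\<close> destroys exactly the cycle through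
  \<open>i\<close>. This accounts for the \<open>+ 1\<close> in the signs of 1-connections.\<close>

lemma num_cycles_perm_graph_remove:
  fixes p :: "'n::finite \<Rightarrow> 'n"
  assumes p: "p permutes UNIV"
  shows "num_cycles (perm_graph p UNIV) = num_cycles (perm_graph p (- {i})) + 1"
proof -
  have perm: "permutation p" unfolding permutation_permutes using p finite by blast
  define T where "T = {O' \<in> range (orbit p). O' \<subseteq> - {i}}"
  have "{O' \<in> range (orbit p). O' \<subseteq> UNIV} = insert (orbit p i) T"
    unfolding T_def using orbit_eq_if_mem[OF perm, of i] by auto
  then have "num_cycles (perm_graph p UNIV) = card (insert (orbit p i) T)"
    unfolding num_cycles_perm_graph[OF p] by (rule arg_cong)
  also have "\<dots> = card T + 1"
  proof -
    have "orbit p i \<notin> T"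
      unfolding T_def using permutation_self_in_orbit[OF perm, of i] by auto
    moreover have "finite T" by (rule finite_class.finite)
    ultimately show ?thesis by simp
  qed
  finally show ?thesis unfolding num_cycles_perm_graph[OF p] T_def .
qed

section \<open>Weights and degree conditions\<close>

lemma weight_perm_graph:
  assumes "mixed_graph D B" "\<Lambda> \<in> R_D D"
  shows "weight \<Lambda> (perm_graph p S) = (\<Prod>v\<in>S. (mat 1 - \<Lambda>) $ v $ p v)"
proof -
  have "inj_on (\<lambda>v. (v, p v)) S" by (auto intro: inj_onI)
  then show ?thesis
    by (simp add: weight_def prod.reindex edge_weight_eq[OF assms] del: vector_minus_component)
qed

text \<open>The out-degrees make the arc set a function on \<open>S\<close>; the in-degrees make
  this function injective with image \<open>T\<close>. Linear subgraphs are the case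
  \<open>S = T = UNIV\<close>, and 1-connections arise from complements of single vertices.\<close>

lemma degrees_iff_bij_betw:
  fixes H :: "'n::finite pair_pre_digraph"
  shows "(\<forall>v. out_degree (with_proj H) v = of_bool (v \<in> S)) \<and>
      (\<forall>v. in_degree (with_proj H) v = of_bool (v \<in> T)) \<longleftrightarrow>
    (\<exists>f. bij_betw f S T \<and> parcs H = (\<lambda>v. (v, f v)) ` S)" (is "?out \<and> ?in \<longleftrightarrow> ?rhs")
proof
  assume "?out \<and> ?in"
  then have o: "card {e \<in> parcs H. fst e = v} = of_bool (v \<in> S)"
    and i: "card {e \<in> parcs H. snd e = v} = of_bool (v \<in> T)" for v
    by (auto simp: out_degree_def in_degree_def out_arcs_def in_arcs_def)
  have "\<exists>w. {e \<in> parcs H. fst e = v} = {(v, w)}" if "v \<in> S" for v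
  proof -
    have "card {e \<in> parcs H. fst e = v} = 1" using o[of v] that by simp
    then obtain e where "{e \<in> parcs H. fst e = v} = {e}" by (rule card_1_singletonE)
    moreover from this have "fst e = v" by blast
    ultimately show ?thesis by (metis prod.collapse)
  qed
  then obtain f where f: "\<And>v. v \<in> S \<Longrightarrow> {e \<in> parcs H. fst e = v} = {(v, f v)}" by metis
  have fS: "fst e \<in> S" if "e \<in> parcs H" for e
  proof (rule ccontr)
    assume "fst e \<notin> S"
    then have "{e' \<in> parcs H. fst e' = fst e} = {}" using o[of "fst e"] by simp
    with that show False by blast
  qed
  have arcs: "parcs H = (\<lambda>v. (v, f v)) ` S"
  proof (intro equalityI subsetI)
    fix e assume e: "e \<in> parcs H"
    then show "e \<in> (\<lambda>v. (v, f v)) ` S" using fS[OF e] f[of "fst e"] by blast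
  next
    fix e assume "e \<in> (\<lambda>v. (v, f v)) ` S"
    then show "e \<in> parcs H" using f by blast
  qed
  have "bij_betw f S T"
  proof (rule bij_betw_imageI)
    show "inj_on f S"
    proof (rule inj_onI)
      fix x y assume xy: "x \<in> S" "y \<in> S" "f x = f y"
      have "card {e \<in> parcs H. snd e = f x} \<le> Suc 0" using i[of "f x"] by simp
      moreover have "(x, f x) \<in> {e \<in> parcs H. snd e = f x}" "(y, f y) \<in> {e \<in> parcs H. snd e = f x}"
        using xy arcs by auto
      ultimately show "x = y" by (auto simp: card_le_Suc0_iff_eq)
    qed
    show "f ` S = T"
    proof (intro equalityI subsetI)
      fix w assume "w \<in> f ` S"
      then have "{e \<in> parcs H. snd e = w} \<noteq> {}" using arcs by auto
      then show "w \<in> T" using i[of w] by (cases "w \<in> T") auto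
    next
      fix w assume "w \<in> T"
      then have "card {e \<in> parcs H. snd e = w} \<noteq> 0" using i[of w] by simp
      then have "{e \<in> parcs H. snd e = w} \<noteq> {}" by auto
      then show "w \<in> f ` S" using arcs by auto
    qed
  qed
  with arcs show ?rhs by blast
next
  assume ?rhs
  then obtain f where f: "bij_betw f S T" and arcs: "parcs H = (\<lambda>v. (v, f v)) ` S" by blast
  have "{e \<in> parcs H. fst e = v} = (if v \<in> S then {(v, f v)} else {})" for v
    by (auto simp: arcs)
  moreover have "{e \<in> parcs H. snd e = v} = (if v \<in> T then {(inv_into S f v, v)} else {})" for v
    using f by (auto simp: arcs bij_betw_def dest: inj_onD)
  ultimately show "?out \<and> ?in"
    by (auto simp: out_degree_def in_degree_def out_arcs_def in_arcs_def)
qed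

lemma spanning_D_tilde_iff:
  "spanning (with_proj H) (with_proj (D_tilde D)) \<longleftrightarrow>
    pverts H = UNIV \<and> parcs H \<subseteq> parcs (D_tilde D)"
  by (auto simp: spanning_def subgraph_def D_tilde_def wf_digraph_def compatible_def)

lemma linear_subgraphs_eq_perm_graphs:
  "linear_subgraphs (D_tilde D) =
    (\<lambda>p. perm_graph p UNIV) ` {p. p permutes UNIV \<and> (\<forall>v. (v, p v) \<in> parcs (D_tilde D))}"
    (is "?L = ?R")
proof (intro equalityI subsetI)
  fix H assume H: "H \<in> ?L"
  then have sp: "pverts H = UNIV" "parcs H \<subseteq> parcs (D_tilde D)"
    by (auto simp: linear_subgraphs_def spanning_D_tilde_iff)
  have "\<exists>f. bij_betw f UNIV UNIV \<and> parcs H = (\<lambda>v. (v, f v)) ` UNIV"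
    unfolding degrees_iff_bij_betw[symmetric] using H sp by (auto simp: linear_subgraphs_def)
  then obtain f where f: "bij f" "parcs H = range (\<lambda>v. (v, f v))" by blast
  have "H = perm_graph f UNIV" using f sp by (simp add: perm_graph_def)
  moreover have "f permutes UNIV" using f by (auto intro: bij_imp_permutes)
  moreover have "\<forall>v. (v, f v) \<in> parcs (D_tilde D)" using sp f by auto
  ultimately show "H \<in> ?R" by blast
next
  fix H assume "H \<in> ?R"
  then obtain p where p: "p permutes UNIV" "H = perm_graph p UNIV"
    "\<forall>v. (v, p v) \<in> parcs (D_tilde D)" by blast
  then have "\<exists>f. bij_betw f UNIV UNIV \<and> parcs H = (\<lambda>v. (v, f v)) ` UNIV"
    using permutes_bij by auto
  then show "H \<in> ?L" unfolding degrees_iff_bij_betw[symmetric]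
    using p by (auto simp: linear_subgraphs_def spanning_D_tilde_iff)
qed

text \<open>Both cases of the definition say the same: no arc leaves the end \<open>i\<close>, none
  enters the start \<open>l\<close>, and all other degrees are one.\<close>

lemma one_connections_degrees:
  "H \<in> one_connections (D_tilde D) l i \<longleftrightarrow>
    pverts H = UNIV \<and> parcs H \<subseteq> parcs (D_tilde D) \<and>
    (\<forall>v. out_degree (with_proj H) v = of_bool (v \<in> - {i})) \<and>
    (\<forall>v. in_degree (with_proj H) v = of_bool (v \<in> - {l}))"
  by (cases "l = i") (auto simp: one_connections_def spanning_D_tilde_iff)

text \<open>The condition \<open>p i = l\<close> closes the path from \<open>l\<close> to
  \<open>i\<close>. The closing arc is not part of the subgraph, so only arcs with tail other than
  \<open>i\<close> must exist.\<close>

lemma one_connections_eq_perm_graphs: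
  "one_connections (D_tilde D) l i = (\<lambda>p. perm_graph p (- {i})) `
    {p. p permutes UNIV \<and> p i = l \<and> (\<forall>v\<in>- {i}. (v, p v) \<in> parcs (D_tilde D))}"
    (is "?L = ?R")
proof (intro equalityI subsetI)
  fix H assume H: "H \<in> ?L"
  then have sp: "pverts H = UNIV" "parcs H \<subseteq> parcs (D_tilde D)"
    and "\<exists>f. bij_betw f (- {i}) (- {l}) \<and> parcs H = (\<lambda>v. (v, f v)) ` (- {i})"
    by (auto simp: one_connections_degrees degrees_iff_bij_betw simp del: Compl_iff)
  then obtain f where f: "bij_betw f (- {i}) (- {l})" "parcs H = (\<lambda>v. (v, f v)) ` (- {i})"
    by blast
  \<comment> \<open>The value of \<open>f\<close> at \<open>i\<close> is arbitrary; resetting it to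
    \<open>l\<close>, the one vertex missing from the image, completes \<open>f\<close> to a
    permutation.\<close>
  have "bij_betw (f(i := l)) (- {i}) (- {l})" using f(1) by (rule bij_betw_cong[THEN iffD1, rotated]) auto
  then have "bij_betw (f(i := l)) (- {i} \<union> {i}) (- {l} \<union> {l})"
    by (rule bij_betw_combine) auto
  then have "f(i := l) permutes UNIV" by (intro bij_imp_permutes) (auto simp: Un_commute)
  moreover have "H = perm_graph (f(i := l)) (- {i})" using f sp by (auto simp: perm_graph_def)
  moreover have "\<forall>v\<in>- {i}. (v, (f(i := l)) v) \<in> parcs (D_tilde D)" using sp f by auto
  moreover have "(f(i := l)) i = l" by simp
  ultimately show "H \<in> ?R" by blast
next
  fix H assume "H \<in> ?R"
  then obtain p where p: "p permutes UNIV" "H = perm_graph p (- {i})" "p i = l"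
    "\<forall>v\<in>- {i}. (v, p v) \<in> parcs (D_tilde D)" by blast
  have "p ` (- {i}) = - {l}"
    using bij_image_Compl_eq[OF permutes_bij[OF p(1)], of "{i}"] p(3) by simp
  then have "bij_betw p (- {i}) (- {l})"
    using permutes_inj_on[OF p(1)] by (auto simp: bij_betw_def)
  then have "\<exists>f. bij_betw f (- {i}) (- {l}) \<and> parcs H = (\<lambda>v. (v, f v)) ` (- {i})"
    using p by auto
  then show "H \<in> ?L" unfolding one_connections_degrees degrees_iff_bij_betw[symmetric]
    using p by auto
qed

text \<open>All loops are present, so a missing arc is an off-diagonal zero of \<Lambda>. Hence
  permutations using a missing arc drop out of the Leibniz sums.\<close>

lemma edge_entry_zero:
  assumes "mixed_graph D B" "\<Lambda> \<in> R_D D" "(v, w) \<notin> parcs (D_tilde D)"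
  shows "(mat 1 - \<Lambda>) $ v $ w = 0"
  using assms by (auto simp: D_tilde_def R_D_def mat_def)

section \<open>Determinant and inverse\<close>

lemma sum_linear_subgraphs:
  fixes \<Lambda> :: "real^'n^'n"
  assumes "mixed_graph D B" "\<Lambda> \<in> R_D D"
  shows "(\<Sum>L \<in> linear_subgraphs (D_tilde D). (-1) ^ num_cycles L * weight \<Lambda> L) =
    (-1) ^ CARD('n) * det (mat 1 - \<Lambda>)"
proof -
  let ?A = "mat 1 - \<Lambda>"
  let ?P = "{p. p permutes (UNIV :: 'n set) \<and> (\<forall>v. (v, p v) \<in> parcs (D_tilde D))}"
  have inj: "inj_on (\<lambda>p. perm_graph p UNIV) ?P"
    by (auto simp: inj_on_def perm_graph_def fun_eq_iff)
  have "(\<Sum>L \<in> linear_subgraphs (D_tilde D). (-1) ^ num_cycles L * weight \<Lambda> L) =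
      (\<Sum>p\<in>?P. (-1) ^ num_cycles (perm_graph p UNIV) * weight \<Lambda> (perm_graph p UNIV))"
    unfolding linear_subgraphs_eq_perm_graphs by (simp add: sum.reindex[OF inj])
  also have "\<dots> = (\<Sum>p\<in>?P. (-1) ^ CARD('n) * (of_int (sign p) * (\<Prod>v\<in>UNIV. ?A $ v $ p v)))"
  proof (rule sum.cong[OF refl])
    fix p assume "p \<in> ?P"
    then have "p permutes UNIV" by simp
    from arg_cong[OF sign_perm_graph_UNIV[OF this], of real_of_int]
    show "(-1) ^ num_cycles (perm_graph p UNIV) * weight \<Lambda> (perm_graph p UNIV) =
        (-1) ^ CARD('n) * (of_int (sign p) * (\<Prod>v\<in>UNIV. ?A $ v $ p v))"
      unfolding weight_perm_graph[OF assms] by (simp del: vector_minus_component)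
  qed
  \<comment> \<open>Each added permutation uses a missing arc and has a zero factor.\<close>
  also have "\<dots> = (\<Sum>p | p permutes UNIV. (-1) ^ CARD('n) * (of_int (sign p) * (\<Prod>v\<in>UNIV. ?A $ v $ p v)))"
  proof (rule sum.mono_neutral_left)
    show "\<forall>p\<in>{p. p permutes UNIV} - ?P.
        (-1) ^ CARD('n) * (of_int (sign p) * (\<Prod>v\<in>UNIV. ?A $ v $ p v)) = 0"
      using edge_entry_zero[OF assms] by (auto simp del: vector_minus_component)
  qed auto
  also have "\<dots> = (-1) ^ CARD('n) * det ?A" by (simp add: det_def sum_distrib_left)
  finally show ?thesis .
qed

text \<open>Column \<open>i\<close> of the inverse solves \<open>A *v x = e_i\<close> for the unit
  vector \<open>e_i\<close>, so Cramer's rule gives the determinant of \<open>A\<close> with column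
  \<open>l\<close> replaced by \<open>e_i\<close>. Expanding it over permutations keeps the sign of
  the whole \<open>p\<close>, matching the closed-up 1-connections.\<close>

lemma matrix_inv_entry_det:
  fixes A :: "real^'n^'n"
  assumes "invertible A"
  shows "matrix_inv A $ l $ i * det A =
    (\<Sum>p | p permutes UNIV \<and> p i = l. of_int (sign p) * (\<Prod>v\<in>- {i}. A $ v $ p v))"
proof -
  define x where "x = column i (matrix_inv A)"
  have "A ** matrix_inv A = mat 1" using assms by (simp add: matrix_inv_def invertible_def) (metis (mono_tags, lifting) someI_ex)
  then have Ax: "(A *v x) $ r = of_bool (r = i)" for r
    by (auto simp: x_def matrix_vector_mult_def column_def matrix_matrix_mult_def mat_def vec_eq_iff)
  let ?M = "(\<chi> r c. if c = l then (A *v x) $ r else A $ r $ c) :: real^'n^'n"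
  have "matrix_inv A $ l $ i * det A = det ?M"
    using cramer_lemma[of l A x] by (simp add: x_def column_def)
  also have "\<dots> = (\<Sum>p | p permutes UNIV. of_int (sign p) * (\<Prod>v\<in>UNIV. ?M $ v $ p v))"
    by (simp add: det_def)
  \<comment> \<open>If \<open>p i\<close> is not \<open>l\<close>, the preimage of \<open>l\<close>
    is a row other than \<open>i\<close>, where the replaced column vanishes.\<close>
  also have "\<dots> = (\<Sum>p | p permutes UNIV \<and> p i = l. of_int (sign p) * (\<Prod>v\<in>UNIV. ?M $ v $ p v))"
  proof (rule sum.mono_neutral_right)
    show "\<forall>p\<in>{p. p permutes UNIV} - {p. p permutes UNIV \<and> p i = l}.
        of_int (sign p) * (\<Prod>v\<in>UNIV. ?M $ v $ p v) = 0"
    proof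
      fix p assume "p \<in> {p. p permutes (UNIV :: 'n set)} - {p. p permutes UNIV \<and> p i = l}"
      then have p: "p permutes UNIV" "p i \<noteq> l" by auto
      obtain v where "p v = l" using permutes_surj[OF p(1)] by (metis surjD)
      then have "?M $ v $ p v = 0" using p Ax by auto
      then show "of_int (sign p) * (\<Prod>v\<in>UNIV. ?M $ v $ p v) = 0"
        by (metis (mono_tags, lifting) UNIV_I finite_class.finite_UNIV mult_zero_right prod_zero)
    qed
  qed auto
  also have "\<dots> = (\<Sum>p | p permutes UNIV \<and> p i = l. of_int (sign p) * (\<Prod>v\<in>- {i}. A $ v $ p v))"
  proof (rule sum.cong[OF refl])
    fix p assume "p \<in> {p. p permutes (UNIV :: 'n set) \<and> p i = l}"
    then have p: "p permutes UNIV" "p i = l" by auto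
    \<comment> \<open>Row \<open>i\<close> contributes the entry 1 of the replaced column; by
      injectivity the other rows avoid column \<open>l\<close> and keep their entries of
      \<open>A\<close>.\<close>
    have "(\<Prod>v\<in>UNIV. ?M $ v $ p v) = ?M $ i $ p i * (\<Prod>v\<in>UNIV - {i}. ?M $ v $ p v)"
      by (rule prod.remove) auto
    also have "\<dots> = (\<Prod>v\<in>- {i}. A $ v $ p v)"
    proof -
      have "p v \<noteq> l" if "v \<noteq> i" for v using that p permutes_inj[OF p(1)] by (auto dest: injD)
      then show ?thesis using p Ax by (auto simp: Compl_eq_Diff_UNIV intro!: prod.cong)
    qed
    finally show "of_int (sign p) * (\<Prod>v\<in>UNIV. ?M $ v $ p v) =
        of_int (sign p) * (\<Prod>v\<in>- {i}. A $ v $ p v)" by simp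
  qed
  finally show ?thesis .
qed

text \<open>The exponent counts the cycles of the closed-up permutation and so yields its sign,
  while the weight lacks the factor of row \<open>i\<close>, exactly as in
  \<open>matrix_inv_entry_det\<close>.\<close>

lemma sum_one_connections:
  fixes \<Lambda> :: "real^'n^'n"
  assumes "mixed_graph D B" "\<Lambda> \<in> R_D D" "invertible (mat 1 - \<Lambda>)"
  shows "(\<Sum>C \<in> one_connections (D_tilde D) l i. (-1) ^ (num_cycles C + 1) * weight \<Lambda> C) =
    (-1) ^ CARD('n) * (matrix_inv (mat 1 - \<Lambda>) $ l $ i * det (mat 1 - \<Lambda>))"
proof -
  let ?A = "mat 1 - \<Lambda>"
  let ?P = "{p. p permutes (UNIV :: 'n set) \<and> p i = l \<and> (\<forall>v\<in>- {i}. (v, p v) \<in> parcs (D_tilde D))}"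
  let ?g = "\<lambda>p. perm_graph p (- {i})"
  have inj: "inj_on ?g ?P"
  proof (rule inj_onI, rule ext)
    fix p q v assume pq: "p \<in> ?P" "q \<in> ?P" "?g p = ?g q"
    then have "(\<lambda>v. (v, p v)) ` (- {i}) = (\<lambda>v. (v, q v)) ` (- {i})"
      by (simp add: perm_graph_def)
    \<comment> \<open>The deleted arc carries no information, since both permutations map
      \<open>i\<close> to \<open>l\<close>.\<close>
    then show "p v = q v" using pq by (cases "v = i") auto
  qed
  have "(\<Sum>C \<in> one_connections (D_tilde D) l i. (-1) ^ (num_cycles C + 1) * weight \<Lambda> C) =
      (\<Sum>p\<in>?P. (-1) ^ (num_cycles (?g p) + 1) * weight \<Lambda> (?g p))"
    unfolding one_connections_eq_perm_graphs by (simp add: sum.reindex[OF inj])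
  also have "\<dots> = (\<Sum>p\<in>?P. (-1) ^ CARD('n) * (of_int (sign p) * (\<Prod>v\<in>- {i}. ?A $ v $ p v)))"
  proof (rule sum.cong[OF refl])
    fix p assume "p \<in> ?P"
    then have p: "p permutes UNIV" by simp
    from arg_cong[OF sign_perm_graph_UNIV[OF p], of real_of_int]
    have "(-1) ^ (num_cycles (?g p) + 1) = (-1) ^ CARD('n) * real_of_int (sign p)"
      unfolding num_cycles_perm_graph_remove[OF p, of i] by simp
    then show "(-1) ^ (num_cycles (?g p) + 1) * weight \<Lambda> (?g p) =
        (-1) ^ CARD('n) * (of_int (sign p) * (\<Prod>v\<in>- {i}. ?A $ v $ p v))"
      unfolding weight_perm_graph[OF assms(1,2)] by (simp only: mult.assoc)
  qed
  also have "\<dots> = (\<Sum>p | p permutes UNIV \<and> p i = l.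
      (-1) ^ CARD('n) * (of_int (sign p) * (\<Prod>v\<in>- {i}. ?A $ v $ p v)))"
  proof (rule sum.mono_neutral_left)
    show "\<forall>p\<in>{p. p permutes UNIV \<and> p i = l} - ?P.
        (-1) ^ CARD('n) * (of_int (sign p) * (\<Prod>v\<in>- {i}. ?A $ v $ p v)) = 0"
      using edge_entry_zero[OF assms(1,2)] by (auto simp del: vector_minus_component)
  qed auto
  also have "\<dots> = (-1) ^ CARD('n) * (matrix_inv ?A $ l $ i * det ?A)"
    unfolding matrix_inv_entry_det[OF assms(3)] by (simp only: sum_distrib_left)
  finally show ?thesis .
qed

section \<open>Entries of the covariance matrix\<close>

theorem theorem3p2:
  fixes D :: "('n::finite \<times> 'n) set" and B :: "'n set set"
    and \<Lambda> \<Omega> \<Sigma> :: "real^'n^'n" and i j :: 'n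
  assumes "mixed_graph D B"
    and "\<Lambda> \<in> R_D_reg D"
    and "\<Omega> \<in> PD B"
    and "\<Sigma> = transpose (matrix_inv (mat 1 - \<Lambda>)) ** \<Omega> ** matrix_inv (mat 1 - \<Lambda>)"
  shows "\<Sigma> $ i $ j =
    (\<Sum>k\<in>UNIV. \<Sum>l\<in>UNIV.
        (\<Sum>C \<in> one_connections (D_tilde D) l i. (-1) ^ (num_cycles C + 1) * weight \<Lambda> C)
        * \<Omega> $ l $ k
        * (\<Sum>C' \<in> one_connections (D_tilde D) k j. (-1) ^ (num_cycles C' + 1) * weight \<Lambda> C'))
    / (\<Sum>L \<in> linear_subgraphs (D_tilde D). (-1) ^ num_cycles L * weight \<Lambda> L)\<^sup>2"
proof -
  have \<Lambda>: "\<Lambda> \<in> R_D D" and inv: "invertible (mat 1 - \<Lambda>)"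
    using assms(2) by (auto simp: R_D_reg_def)
  \<comment> \<open>This is the common factor: the denominator is its square, and each sum over
    1-connections is an entry of the inverse times \<open>d\<close>.\<close>
  define d where "d = (-1) ^ CARD('n) * det (mat 1 - \<Lambda>)"
  define M where "M = matrix_inv (mat 1 - \<Lambda>)"
  have d: "d \<noteq> 0" using inv by (simp add: d_def invertible_det_nz)
  have conn: "(\<Sum>C \<in> one_connections (D_tilde D) l i. (-1) ^ (num_cycles C + 1) * weight \<Lambda> C) =
      M $ l $ i * d" for l i
    unfolding sum_one_connections[OF assms(1) \<Lambda> inv] by (simp add: d_def M_def)
  have lin: "(\<Sum>L \<in> linear_subgraphs (D_tilde D). (-1) ^ num_cycles L * weight \<Lambda> L) = d"
    unfolding sum_linear_subgraphs[OF assms(1) \<Lambda>] d_def ..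
  have "\<Sigma> $ i $ j = (\<Sum>k\<in>UNIV. \<Sum>l\<in>UNIV. M $ l $ i * \<Omega> $ l $ k * M $ k $ j)"
    by (simp add: assms(4) M_def matrix_matrix_mult_def transpose_def sum_distrib_right)
  \<comment> \<open>One factor \<open>d\<close> goes to each of the two inverse entries;
    invertibility makes \<open>d\<close> nonzero, so the division undoes this.\<close>
  also have "\<dots> = (\<Sum>k\<in>UNIV. \<Sum>l\<in>UNIV. M $ l $ i * d * \<Omega> $ l $ k * (M $ k $ j * d)) / d\<^sup>2"
    using d by (simp add: sum_divide_distrib power2_eq_square mult.assoc)
  finally show ?thesis unfolding conn lin .
qed

end
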